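(* Let $G$ be a finite additive abelian group and let $\Sigma=(\Gamma,\sigma)$ be a signed graph with underlying graph $\Gamma=(V,E)$. Then the number $q_\Sigma(G)$ of nowhere-zero $G$-flows of $\Sigma$ is $$q_\Sigma(G)=(-1)^{|E|-|V|+k(\Gamma)}\,T_\Sigma\Big(0,\;1-|G|,\;1-\frac{|G|}{|2G|}\Big).$$
   Context: A signed graph $\Sigma=(\Gamma,\sigma)$ consists of a finite graph $\Gamma=(V,E)$ (loops and multiple edges allowed) and a signature $\sigma:E\to\{-1,1\}$. A cycle (a loop counts as a cycle of length one) is balanced if the product of the signs of its edges is $1$ and unbalanced otherwise; a signed graph is balanced if all its cycles are balanced. For $A\subseteq E$, $\Sigma\backslash A^c$ denotes the spanning signed subgraph $(V,A)$ with $\sigma$ restricted to $A$. $k(\cdot)$ is the number of connected components of the underlying graph, and $k_b(\cdot)$, $k_u(\cdot)$ are the numbers of balanced and unbalanced connected components. The signed Tutte polynomial is $$T_\Sigma(X,Y,Z)=\sum_{A\subseteq E}(X-1)^{k(\Sigma\backslash A^c)-k(\Sigma)}(Y-1)^{|A|-|V|+k_b(\Sigma\backslash A^c)}(Z-1)^{k_u(\Sigma\backslash A^c)}.$$ Each edge $e$ has two half-edges $(u,e)$ and $(v,e)$ at its endpoints $u,v$ (a loop at $v$ has two half-edges at $v$). An orientation $\omega$ assigns $\omega(v,e)\in\{-1,1\}$ to each half-edge; it is compatible with $\sigma$ if $\sigma(e)=-\omega(u,e)\omega(v,e)$ for every edge $e$ with half-edges $(u,e),(v,e)$. A $G$-flow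 of $\Sigma$ is a map $f:E\to G$ such that for some (equivalently any, for counting purposes) orientation $\omega$ compatible with $\sigma$, for every vertex $v$, $\sum \omega(v,e)f(e)=0$, the sum over all half-edges $(v,e)$ at $v$ (a loop at $v$ contributes two terms). It is nowhere-zero if $f(e)\ne0$ for all $e$. Here $2G=\{x+x:x\in G\}$. *)

theory Defs
  imports Complex_Main "HOL-Library.FuncSet" "HOL-Library.Cardinality"
begin

text \<open>
  Graphs may have loops and multiple edges. An edge \<open>e\<close> has exactly two half-edges, named
  \<open>(e, False)\<close> and \<open>(e, True)\<close>; the half-edge \<open>(e, b)\<close> sits at the vertex \<open>endpoint \<Sigma> e b\<close>,
  so that a loop has two distinct half-edges at the same vertex. The naming is mere bookkeeping
  and does not orient the edge.
\<close>

record ('v, 'e) sgraph =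
  verts :: "'v set"
  edges :: "'e set"
  endpoint :: "'e \<Rightarrow> bool \<Rightarrow> 'v"
  esign :: "'e \<Rightarrow> int"

locale signed_graph =
  fixes \<Sigma> :: "('v, 'e) sgraph"
  assumes finite_verts: "finite (verts \<Sigma>)"
    and finite_edges: "finite (edges \<Sigma>)"
    and endpoint_in_verts: "e \<in> edges \<Sigma> \<Longrightarrow> endpoint \<Sigma> e b \<in> verts \<Sigma>"
    and esign_values: "e \<in> edges \<Sigma> \<Longrightarrow> esign \<Sigma> e \<in> {-1, 1}"

text \<open>\<open>spanning_sub \<Sigma> A\<close> is the spanning signed subgraph \<open>\<Sigma> \ A\<^sup>c = (V, A)\<close>.\<close>

definition spanning_sub :: "('v, 'e) sgraph \<Rightarrow> 'e set \<Rightarrow> ('v, 'e) sgraph" where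
  "spanning_sub \<Sigma> A = \<Sigma>\<lparr>edges := A\<rparr>"

definition induced_sub :: "('v, 'e) sgraph \<Rightarrow> 'v set \<Rightarrow> ('v, 'e) sgraph" where
  "induced_sub \<Sigma> C = \<Sigma>\<lparr>verts := C, edges := {e \<in> edges \<Sigma>. \<forall>b. endpoint \<Sigma> e b \<in> C}\<rparr>"

text \<open>
  A cycle with vertices \<open>v\<^sub>0, \<dots>, v\<^sub>n\<^sub>-\<^sub>1\<close> and edges \<open>e\<^sub>0, \<dots>, e\<^sub>n\<^sub>-\<^sub>1\<close> (\<open>n \<ge> 1\<close>), all distinct, where
  \<open>e\<^sub>i\<close> joins \<open>v\<^sub>i\<close> to its cyclic successor. For \<open>n = 1\<close> this is a loop, for \<open>n = 2\<close> a pair of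
  parallel edges.
\<close>

definition is_cycle :: "('v, 'e) sgraph \<Rightarrow> 'v list \<Rightarrow> 'e list \<Rightarrow> bool" where
  "is_cycle \<Sigma> vs es \<longleftrightarrow>
     es \<noteq> [] \<and> length vs = length es \<and> distinct vs \<and> distinct es \<and>
     set vs \<subseteq> verts \<Sigma> \<and> set es \<subseteq> edges \<Sigma> \<and>
     (\<forall>i < length es. \<exists>b. endpoint \<Sigma> (es ! i) b = vs ! i \<and>
        endpoint \<Sigma> (es ! i) (\<not> b) = vs ! (Suc i mod length es))"

definition balanced :: "('v, 'e) sgraph \<Rightarrow> bool" where
  "balanced \<Sigma> \<longleftrightarrow>
     (\<forall>vs es. is_cycle \<Sigma> vs es \<longrightarrow> prod_list (map (esign \<Sigma>) es) = 1)"

definition adj_rel :: "('v, 'e) sgraph \<Rightarrow> 'v rel" where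
  "adj_rel \<Sigma> = {(endpoint \<Sigma> e b, endpoint \<Sigma> e (\<not> b)) | e b. e \<in> edges \<Sigma>}"

definition conn_rel :: "('v, 'e) sgraph \<Rightarrow> 'v rel" where
  "conn_rel \<Sigma> = (adj_rel \<Sigma>)\<^sup>* \<inter> verts \<Sigma> \<times> verts \<Sigma>"

definition components :: "('v, 'e) sgraph \<Rightarrow> 'v set set" where
  "components \<Sigma> = verts \<Sigma> // conn_rel \<Sigma>"

definition num_comps :: "('v, 'e) sgraph \<Rightarrow> nat" where
  "num_comps \<Sigma> = card (components \<Sigma>)"

definition num_balanced :: "('v, 'e) sgraph \<Rightarrow> nat" where
  "num_balanced \<Sigma> = card {C \<in> components \<Sigma>. balanced (induced_sub \<Sigma> C)}"

definition num_unbalanced :: "('v, 'e) sgraph \<Rightarrow> nat" where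
  "num_unbalanced \<Sigma> = card {C \<in> components \<Sigma>. \<not> balanced (induced_sub \<Sigma> C)}"

text \<open>
  The value of the signed Tutte polynomial at a point. All exponents are in fact nonnegative;
  integer exponents are used so that the formula involves no truncated subtraction.
\<close>

definition signed_tutte :: "('v, 'e) sgraph \<Rightarrow> 'a::field \<Rightarrow> 'a \<Rightarrow> 'a \<Rightarrow> 'a" where
  "signed_tutte \<Sigma> X Y Z =
     (\<Sum>A\<in>Pow (edges \<Sigma>).
        (X - 1) powi (int (num_comps (spanning_sub \<Sigma> A)) - int (num_comps \<Sigma>)) *
        (Y - 1) powi (int (card A) - int (card (verts \<Sigma>))
                        + int (num_balanced (spanning_sub \<Sigma> A))) *
        (Z - 1) powi int (num_unbalanced (spanning_sub \<Sigma> A)))"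

definition compatible :: "('v, 'e) sgraph \<Rightarrow> ('e \<Rightarrow> bool \<Rightarrow> int) \<Rightarrow> bool" where
  "compatible \<Sigma> \<omega> \<longleftrightarrow>
     (\<forall>e \<in> edges \<Sigma>. (\<forall>b. \<omega> e b \<in> {-1, 1}) \<and> esign \<Sigma> e = - (\<omega> e False * \<omega> e True))"

lemma (in signed_graph) compatible_exists: "\<exists>\<omega>. compatible \<Sigma> \<omega>"
proof
  show "compatible \<Sigma> (\<lambda>e b. if b then 1 else - esign \<Sigma> e)"
    using esign_values by (fastforce simp: compatible_def)
qed

text \<open>The product of a sign \<open>s \<in> {-1, 1}\<close> with a group element.\<close>

definition sign_mult :: "int \<Rightarrow> 'g::ab_group_add \<Rightarrow> 'g" where
  "sign_mult s x = (if s = 1 then x else - x)"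

text \<open>
  Flows are maps on the edge set (hence extensional functions), taken with respect to a fixed
  compatible orientation \<open>\<omega>\<close>: the set of flows depends on \<open>\<omega>\<close>, its cardinality does not.
\<close>

definition is_flow ::
    "('v, 'e) sgraph \<Rightarrow> ('e \<Rightarrow> bool \<Rightarrow> int) \<Rightarrow> ('e \<Rightarrow> 'g::ab_group_add) \<Rightarrow> bool" where
  "is_flow \<Sigma> \<omega> f \<longleftrightarrow>
     f \<in> edges \<Sigma> \<rightarrow>\<^sub>E UNIV \<and>
     (\<forall>v \<in> verts \<Sigma>.
        (\<Sum>(e, b) \<in> {(e, b). e \<in> edges \<Sigma> \<and> endpoint \<Sigma> e b = v}. sign_mult (\<omega> e b) (f e)) = 0)"

definition nowhere_zero_flows ::
    "('v, 'e) sgraph \<Rightarrow> ('e \<Rightarrow> bool \<Rightarrow> int) \<Rightarrow> ('e \<Rightarrow> 'g::ab_group_add) set" where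
  "nowhere_zero_flows \<Sigma> \<omega> = {f. is_flow \<Sigma> \<omega> f \<and> (\<forall>e \<in> edges \<Sigma>. f e \<noteq> 0)}"

end

theory Submission
  imports Defs
begin

text \<open>
  Inclusion-exclusion over the support reduces the count of nowhere-zero flows to the numbers of all
  flows of the spanning subgraphs \<open>(V, A)\<close>. These are the kernels of the boundary maps
  \<open>G\<^sup>A \<rightarrow> G\<^sup>V\<close>, so it suffices to know the images. Weight every vertex by the sign of a walk joining it
  to a chosen representative of its component. Then \<open>g\<close> is a boundary iff on each component the
  weighted sum of \<open>g\<close> vanishes (balanced case) or lies in \<open>2G\<close> (unbalanced case), whence the image
  has \<open>|G|\<close> to the power \<open>|V| - k\<close> times \<open>|2G|\<close> to the power \<open>k\<^sub>u\<close> elements.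
\<close>

section \<open>Walks and their signs\<close>

definition dart_src :: "('v, 'e) sgraph \<Rightarrow> 'e \<times> bool \<Rightarrow> 'v" where
  "dart_src \<Sigma> d = endpoint \<Sigma> (fst d) (snd d)"

definition dart_tgt :: "('v, 'e) sgraph \<Rightarrow> 'e \<times> bool \<Rightarrow> 'v" where
  "dart_tgt \<Sigma> d = endpoint \<Sigma> (fst d) (\<not> snd d)"

text \<open>A walk is a list of darts, each an edge with the half-edge from which it is left.
  Vertices alone would not tell parallel edges apart, and a loop has two darts.\<close>

fun walk :: "('v, 'e) sgraph \<Rightarrow> 'v \<Rightarrow> ('e \<times> bool) list \<Rightarrow> 'v \<Rightarrow> bool" where
  "walk \<Sigma> u [] v \<longleftrightarrow> u = v"
| "walk \<Sigma> u (d # ds) v \<longleftrightarrow>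
     fst d \<in> edges \<Sigma> \<and> dart_src \<Sigma> d = u \<and> walk \<Sigma> (dart_tgt \<Sigma> d) ds v"

definition wsign :: "('v, 'e) sgraph \<Rightarrow> ('e \<times> bool) list \<Rightarrow> int" where
  "wsign \<Sigma> ds = prod_list (map (esign \<Sigma> \<circ> fst) ds)"

lemma wsign_simps [simp]:
  "wsign \<Sigma> [] = 1"
  "wsign \<Sigma> (d # ds) = esign \<Sigma> (fst d) * wsign \<Sigma> ds"
  "wsign \<Sigma> (ds @ ds') = wsign \<Sigma> ds * wsign \<Sigma> ds'"
  by (simp_all add: wsign_def)

lemma walk_append:
  "walk \<Sigma> u (ds @ ds') v \<longleftrightarrow> (\<exists>w. walk \<Sigma> u ds w \<and> walk \<Sigma> w ds' v)"
  by (induction ds arbitrary: u) auto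

lemma walk_edges: "walk \<Sigma> u ds v \<Longrightarrow> fst ` set ds \<subseteq> edges \<Sigma>"
  by (induction ds arbitrary: u) auto

text \<open>Reverse the list and flip each dart. The sign reads only the edges, in a commutative
  product, so it survives.\<close>

lemma walk_reverse:
  assumes "walk \<Sigma> u ds v"
  obtains ds' where "walk \<Sigma> v ds' u" "wsign \<Sigma> ds' = wsign \<Sigma> ds"
proof -
  have "\<exists>ds'. walk \<Sigma> v ds' u \<and> wsign \<Sigma> ds' = wsign \<Sigma> ds"
    using assms
  proof (induction ds arbitrary: u)
    case Nil
    then have "walk \<Sigma> v [] u \<and> wsign \<Sigma> [] = wsign \<Sigma> []" by simp
    then show ?case ..
  next
    case (Cons d ds)
    then obtain ds' where "walk \<Sigma> v ds' (dart_tgt \<Sigma> d)" "wsign \<Sigma> ds' = wsign \<Sigma> ds"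
      by auto
    moreover have "walk \<Sigma> (dart_tgt \<Sigma> d) [(fst d, \<not> snd d)] u"
      using Cons.prems by (simp add: dart_src_def dart_tgt_def)
    ultimately have "walk \<Sigma> v (ds' @ [(fst d, \<not> snd d)]) u \<and>
        wsign \<Sigma> (ds' @ [(fst d, \<not> snd d)]) = wsign \<Sigma> (d # ds)"
      unfolding walk_append by auto
    then show ?case ..
  qed
  then show ?thesis using that by blast
qed

lemma walk_nth_src:
  "walk \<Sigma> u ds v \<Longrightarrow> ds \<noteq> [] \<Longrightarrow> dart_src \<Sigma> (ds ! 0) = u"
  by (cases ds) auto

lemma walk_nth_tgt:
  assumes "walk \<Sigma> u ds v" "i < length ds"
  shows "dart_tgt \<Sigma> (ds ! i) = (if Suc i < length ds then dart_src \<Sigma> (ds ! Suc i) else v)"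
  using assms
proof (induction ds arbitrary: u i)
  case (Cons d ds)
  then show ?case
    by (cases i; cases ds) auto
qed simp

lemma adj_walk: "(u, v) \<in> (adj_rel \<Sigma>)\<^sup>* \<Longrightarrow> \<exists>ds. walk \<Sigma> u ds v"
proof (induction rule: converse_rtrancl_induct)
  case base
  have "walk \<Sigma> v [] v" by simp
  then show ?case ..
next
  case (step u w)
  then obtain e b ds where "e \<in> edges \<Sigma>" "u = endpoint \<Sigma> e b" "w = endpoint \<Sigma> e (\<not> b)"
      "walk \<Sigma> w ds v"
    by (auto simp: adj_rel_def)
  then have "walk \<Sigma> u ((e, b) # ds) v"
    by (simp add: dart_src_def dart_tgt_def)
  then show ?case ..
qed

section \<open>Negative closed walks and balance\<close>

context signed_graph
begin

lemma esign_square: "e \<in> edges \<Sigma> \<Longrightarrow> esign \<Sigma> e * esign \<Sigma> e = 1"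
  using esign_values[of e] by auto

lemma wsign_values:
  assumes "walk \<Sigma> u ds v"
  shows "wsign \<Sigma> ds \<in> {-1, 1}"
  using assms
proof (induction ds arbitrary: u)
  case (Cons d ds)
  then have "wsign \<Sigma> ds \<in> {-1, 1}" "esign \<Sigma> (fst d) \<in> {-1, 1}"
    using esign_values by auto
  then show ?case by auto
qed simp

text \<open>
  A shortest negative closed walk is a cycle: at a repeated vertex, or a repeated edge, it would
  split into two shorter closed walks, one of which is negative.
\<close>

lemma negative_closed_walk_unbalanced:
  assumes "walk \<Sigma> u ds u" "wsign \<Sigma> ds = -1"
  shows "\<not> balanced \<Sigma>"
proof -
  let ?neg = "\<lambda>ds. wsign \<Sigma> ds = -1 \<and> (\<exists>u. walk \<Sigma> u ds u)"
  have "\<exists>ds. ?neg ds \<and> (\<forall>ds'. ?neg ds' \<longrightarrow> length ds \<le> length ds')"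
    using assms by (intro ex_has_least_nat[of ?neg ds length]) auto
  then obtain ds u where wk: "walk \<Sigma> u ds u" and neg: "wsign \<Sigma> ds = -1"
    and min: "\<And>ds' u'. walk \<Sigma> u' ds' u' \<Longrightarrow> wsign \<Sigma> ds' = -1 \<Longrightarrow> length ds \<le> length ds'"
    by blast
  have short: "wsign \<Sigma> ds' = 1" if "walk \<Sigma> u' ds' u'" "length ds' < length ds" for u' ds'
    using wsign_values[OF that(1)] min[OF that(1)] that(2) by auto
  have ne: "ds \<noteq> []" using neg by auto
  have dv: "distinct (map (dart_src \<Sigma>) ds)"
  proof (rule ccontr)
    assume "\<not> distinct (map (dart_src \<Sigma>) ds)"
    then obtain xs ys zs y where "map (dart_src \<Sigma>) ds = xs @ [y] @ ys @ [y] @ zs"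
      using not_distinct_decomp by blast
    then obtain p d q d' r where ds: "ds = p @ d # q @ d' # r"
      and y: "dart_src \<Sigma> d = y" "dart_src \<Sigma> d' = y"
      by (fastforce simp: map_eq_append_conv map_eq_Cons_conv Cons_eq_map_conv append_eq_map_conv)
    have "walk \<Sigma> u p y" "walk \<Sigma> y (d # q) y" "walk \<Sigma> y (d' # r) u"
      using wk y unfolding ds by (auto simp: walk_append)
    then have w: "walk \<Sigma> u (p @ d' # r) u" "walk \<Sigma> y (d # q) y"
      by (auto simp only: walk_append)
    have "wsign \<Sigma> (p @ d' # r) = 1" "wsign \<Sigma> (d # q) = 1"
      by (rule short[OF w(1)], simp add: ds, rule short[OF w(2)], simp add: ds)
    moreover have "wsign \<Sigma> ds = wsign \<Sigma> (p @ d' # r) * wsign \<Sigma> (d # q)"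
      by (simp add: ds)
    ultimately show False using neg by simp
  qed
  have de: "distinct (map fst ds)"
  proof (rule ccontr)
    assume "\<not> distinct (map fst ds)"
    then obtain xs ys zs e where "map fst ds = xs @ [e] @ ys @ [e] @ zs"
      using not_distinct_decomp by blast
    then obtain p d q d' r where ds: "ds = p @ d # q @ d' # r"
      and e: "fst d = e" "fst d' = e"
      by (fastforce simp: map_eq_append_conv map_eq_Cons_conv Cons_eq_map_conv append_eq_map_conv)
    \<comment> \<open>By \<open>dv\<close> the two traversals of \<open>e\<close> leave from
      different vertices, so they run in opposite directions. Deleting both leaves the closed walks
      \<open>p @ r\<close> and \<open>q\<close>, and the sign of \<open>e\<close> enters as a
      square.\<close>
    have "dart_src \<Sigma> d \<noteq> dart_src \<Sigma> d'"
      using dv by (simp add: ds)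
    moreover have "dart_src \<Sigma> d = dart_src \<Sigma> d'" if "snd d = snd d'"
      using e that by (simp add: dart_src_def)
    ultimately have "snd d \<noteq> snd d'" by blast
    then have "snd d' = (\<not> snd d)" by auto
    then have opp: "dart_src \<Sigma> d' = dart_tgt \<Sigma> d" "dart_tgt \<Sigma> d' = dart_src \<Sigma> d"
      using e by (auto simp: dart_src_def dart_tgt_def)
    have eE: "e \<in> edges \<Sigma>" using walk_edges[OF wk] e by (auto simp: ds)
    have "walk \<Sigma> u p (dart_src \<Sigma> d)" "walk \<Sigma> (dart_tgt \<Sigma> d) q (dart_tgt \<Sigma> d)"
      "walk \<Sigma> (dart_src \<Sigma> d) r u"
      using wk opp unfolding ds by (auto simp: walk_append)
    then have w: "walk \<Sigma> u (p @ r) u" "walk \<Sigma> (dart_tgt \<Sigma> d) q (dart_tgt \<Sigma> d)"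
      by (auto simp only: walk_append)
    have "wsign \<Sigma> (p @ r) = 1" "wsign \<Sigma> q = 1"
      by (rule short[OF w(1)], simp add: ds, rule short[OF w(2)], simp add: ds)
    moreover have "wsign \<Sigma> ds = wsign \<Sigma> (p @ r) * wsign \<Sigma> q * (esign \<Sigma> e * esign \<Sigma> e)"
      by (simp add: ds e)
    ultimately show False using neg esign_square[OF eE] by simp
  qed
  have "is_cycle \<Sigma> (map (dart_src \<Sigma>) ds) (map fst ds)"
    unfolding is_cycle_def
  proof (intro conjI allI impI)
    show "set (map (dart_src \<Sigma>) ds) \<subseteq> verts \<Sigma>"
      using walk_edges[OF wk] endpoint_in_verts by (auto simp: dart_src_def)
    show "set (map fst ds) \<subseteq> edges \<Sigma>"
      using walk_edges[OF wk] by simp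
    fix i assume "i < length (map fst ds)"
    then have i: "i < length ds" by simp
    have "dart_tgt \<Sigma> (ds ! i) = dart_src \<Sigma> (ds ! (Suc i mod length ds))"
    proof (cases "Suc i < length ds")
      case True
      then show ?thesis using walk_nth_tgt[OF wk i] by simp
    next
      case False
      \<comment> \<open>Here the index wraps around to \<open>0\<close>, and the last dart ends at
        \<open>u\<close>, the source of the first one.\<close>
      then have "Suc i = length ds" using i by simp
      then show ?thesis using walk_nth_tgt[OF wk i] walk_nth_src[OF wk ne] by simp
    qed
    moreover have "Suc i mod length ds < length ds" using ne by simp
    ultimately show "\<exists>b. endpoint \<Sigma> (map fst ds ! i) b = map (dart_src \<Sigma>) ds ! i \<and>
        endpoint \<Sigma> (map fst ds ! i) (\<not> b) =
          map (dart_src \<Sigma>) ds ! (Suc i mod length (map fst ds))"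
      using i by (auto simp: dart_src_def dart_tgt_def)
  qed (use ne dv de in auto)
  moreover have "prod_list (map (esign \<Sigma>) (map fst ds)) = -1"
    using neg by (simp add: wsign_def)
  ultimately show ?thesis
    unfolding balanced_def by fastforce
qed

text \<open>Along a cycle each vertex is met by exactly two edge ends, so the product of the signs
  is the square of the product of \<open>s\<close> over its vertices.\<close>

lemma switching_balanced:
  fixes s :: "'v \<Rightarrow> int"
  assumes s: "\<And>v. v \<in> verts \<Sigma> \<Longrightarrow> s v \<in> {-1, 1}"
    and sw: "\<And>e. e \<in> edges \<Sigma> \<Longrightarrow>
      esign \<Sigma> e = s (endpoint \<Sigma> e False) * s (endpoint \<Sigma> e True)"
  shows "balanced \<Sigma>"
  unfolding balanced_def
proof (intro allI impI)
  fix vs es assume c: "is_cycle \<Sigma> vs es"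
  then have len: "length vs = length es" and vs: "set vs \<subseteq> verts \<Sigma>"
    by (auto simp: is_cycle_def)
  \<comment> \<open>\<open>rotate1 vs\<close> lists the cyclic successors of the entries of
    \<open>vs\<close>; rotating does not change the product of \<open>s\<close>.\<close>
  have "map (esign \<Sigma>) es = map2 (\<lambda>u v. s u * s v) vs (rotate1 vs)"
  proof (rule nth_equalityI)
    fix i assume "i < length (map (esign \<Sigma>) es)"
    then have i: "i < length es" by simp
    then obtain b where b: "endpoint \<Sigma> (es ! i) b = vs ! i"
      "endpoint \<Sigma> (es ! i) (\<not> b) = vs ! (Suc i mod length es)" and "es ! i \<in> edges \<Sigma>"
      using c unfolding is_cycle_def by (meson nth_mem subsetD)
    then have "esign \<Sigma> (es ! i) = s (vs ! i) * s (vs ! (Suc i mod length es))"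
      using sw[of "es ! i"] by (cases b) (auto simp: mult.commute)
    then show "map (esign \<Sigma>) es ! i = map2 (\<lambda>u v. s u * s v) vs (rotate1 vs) ! i"
      using i len by (simp add: nth_rotate1)
  qed (simp add: len)
  moreover have "prod_list (map2 (\<lambda>u v. s u * s v) xs ys) = prod_list (map s xs) * prod_list (map s ys)"
    if "length xs = length ys" for xs ys
    using that by (induction xs ys rule: list_induct2) auto
  moreover have "prod_list (map s (rotate1 vs)) = prod_list (map s vs)"
    by (cases vs) auto
  moreover have "prod_list (map s vs) \<in> {-1, 1}"
    using vs
  proof (induction vs)
    case (Cons v vs)
    then have "prod_list (map s vs) \<in> {-1, 1}" "s v \<in> {-1, 1}" using s by auto
    then show ?case by auto
  qed simp
  ultimately show "prod_list (map (esign \<Sigma>) es) = 1"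
    by auto
qed

end

section \<open>Components, their representatives and balance\<close>

lemma wsign_induced_sub: "wsign (induced_sub \<Sigma> C) ds = wsign \<Sigma> ds"
  by (simp add: wsign_def induced_sub_def)

context signed_graph
begin

lemma equiv_conn_rel: "equiv (verts \<Sigma>) (conn_rel \<Sigma>)"
proof -
  have "sym (adj_rel \<Sigma>)"
  proof (rule symI)
    fix u v assume "(u, v) \<in> adj_rel \<Sigma>"
    then obtain e b where "e \<in> edges \<Sigma>" "u = endpoint \<Sigma> e b" "v = endpoint \<Sigma> e (\<not> b)"
      by (auto simp: adj_rel_def)
    then have "e \<in> edges \<Sigma> \<and> v = endpoint \<Sigma> e (\<not> b) \<and> u = endpoint \<Sigma> e (\<not> \<not> b)"
      by simp
    then show "(v, u) \<in> adj_rel \<Sigma>"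
      unfolding adj_rel_def by blast
  qed
  then have "sym ((adj_rel \<Sigma>)\<^sup>*)" by (rule sym_rtrancl)
  then show ?thesis
    by (intro equivI) (auto simp: conn_rel_def refl_on_def sym_def trans_def)
qed

text \<open>The choice depends only on the class of \<open>v\<close>, so connected vertices receive
  the same representative.\<close>

definition rep :: "'v \<Rightarrow> 'v" where
  "rep v = (SOME u. u \<in> conn_rel \<Sigma> `` {v})"

definition reps :: "'v set" where
  "reps = rep ` verts \<Sigma>"

text \<open>Closed walks at a base point replace cycles because they can be concatenated with other
  walks. For a representative the condition will mean that its component is unbalanced.\<close>

definition negative :: "'v \<Rightarrow> bool" where
  "negative r \<longleftrightarrow> (\<exists>ds. walk \<Sigma> r ds r \<and> wsign \<Sigma> ds = -1)"

text \<open>If \<open>rep v\<close> is negative, walks of both signs reach \<open>v\<close> and the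
  choice is arbitrary. Otherwise the value is determined, and it switches the component to all signs
  positive.\<close>

definition walk_sign :: "'v \<Rightarrow> int" where
  "walk_sign v = (SOME t. \<exists>ds. walk \<Sigma> (rep v) ds v \<and> wsign \<Sigma> ds = t)"

lemma rep_conn: "v \<in> verts \<Sigma> \<Longrightarrow> (v, rep v) \<in> conn_rel \<Sigma>"
proof -
  assume "v \<in> verts \<Sigma>"
  then have "v \<in> conn_rel \<Sigma> `` {v}" by (rule equiv_class_self[OF equiv_conn_rel])
  then have "rep v \<in> conn_rel \<Sigma> `` {v}" unfolding rep_def by (rule someI)
  then show ?thesis by simp
qed

lemma rep_in_verts: "v \<in> verts \<Sigma> \<Longrightarrow> rep v \<in> verts \<Sigma>"
  using rep_conn by (auto simp: conn_rel_def)

lemma rep_eq: "(u, v) \<in> conn_rel \<Sigma> \<Longrightarrow> rep u = rep v"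
  using equiv_class_eq[OF equiv_conn_rel] by (simp add: rep_def)

lemma rep_idem: "v \<in> verts \<Sigma> \<Longrightarrow> rep (rep v) = rep v"
  using rep_eq rep_conn by metis

lemma reps_subset: "reps \<subseteq> verts \<Sigma>"
  using rep_in_verts by (auto simp: reps_def)

lemma finite_reps: "finite reps"
  using finite_subset[OF reps_subset finite_verts] .

lemma rep_of_reps: "r \<in> reps \<Longrightarrow> rep r = r"
  using rep_idem by (auto simp: reps_def)

lemma rep_endpoint:
  assumes "e \<in> edges \<Sigma>"
  shows "rep (endpoint \<Sigma> e b) = rep (endpoint \<Sigma> e b')"
proof -
  have "(endpoint \<Sigma> e c, endpoint \<Sigma> e (\<not> c)) \<in> conn_rel \<Sigma>" for c
    using assms endpoint_in_verts by (auto simp: conn_rel_def adj_rel_def)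
  from rep_eq[OF this] show ?thesis
    by (cases "b = b'") auto
qed

lemma walk_sign_walk:
  assumes "v \<in> verts \<Sigma>"
  obtains ds where "walk \<Sigma> (rep v) ds v" "wsign \<Sigma> ds = walk_sign v"
proof -
  have "(rep v, v) \<in> conn_rel \<Sigma>"
    using rep_conn[OF assms] equiv_conn_rel by (auto simp: equiv_def sym_def)
  then obtain ds where "walk \<Sigma> (rep v) ds v"
    using adj_walk by (force simp: conn_rel_def)
  then have "\<exists>t ds. walk \<Sigma> (rep v) ds v \<and> wsign \<Sigma> ds = t" by blast
  from someI_ex[OF this] show ?thesis
    using that unfolding walk_sign_def by blast
qed

lemma walk_sign_values: "v \<in> verts \<Sigma> \<Longrightarrow> walk_sign v \<in> {-1, 1}"
  using walk_sign_walk wsign_values by metis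

text \<open>Go from the representative to one end of \<open>e\<close>, cross \<open>e\<close>, and
  return from the other end. This closed walk has sign \<open>1\<close> since the representative is
  not negative.\<close>

lemma esign_eq_walk_sign:
  assumes e: "e \<in> edges \<Sigma>" and "\<not> negative (rep (endpoint \<Sigma> e False))"
  shows "esign \<Sigma> e = walk_sign (endpoint \<Sigma> e False) * walk_sign (endpoint \<Sigma> e True)"
proof -
  let ?u = "endpoint \<Sigma> e False" and ?v = "endpoint \<Sigma> e True"
  have uv: "?u \<in> verts \<Sigma>" "?v \<in> verts \<Sigma>" using e endpoint_in_verts by auto
  obtain p where p: "walk \<Sigma> (rep ?u) p ?u" "wsign \<Sigma> p = walk_sign ?u"
    using walk_sign_walk[OF uv(1)] .
  obtain q where q: "walk \<Sigma> (rep ?v) q ?v" "wsign \<Sigma> q = walk_sign ?v"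
    using walk_sign_walk[OF uv(2)] .
  obtain q' where q': "walk \<Sigma> ?v q' (rep ?v)" "wsign \<Sigma> q' = wsign \<Sigma> q"
    using walk_reverse[OF q(1)] .
  have "walk \<Sigma> (rep ?u) (p @ (e, False) # q') (rep ?u)"
    using p q' e rep_endpoint[OF e, of False True]
    by (auto simp: walk_append dart_src_def dart_tgt_def)
  then have "wsign \<Sigma> (p @ (e, False) # q') = 1"
    using assms(2) wsign_values unfolding negative_def by blast
  then have "walk_sign ?u * (esign \<Sigma> e * walk_sign ?v) = 1"
    by (simp add: p q q')
  then show ?thesis
    using walk_sign_values[OF uv(1)] walk_sign_values[OF uv(2)] by auto
qed

lemma inj_on_component: "inj_on (\<lambda>r. conn_rel \<Sigma> `` {r}) reps"
proof (rule inj_onI)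
  fix r r' assume r: "r \<in> reps" "r' \<in> reps" "conn_rel \<Sigma> `` {r} = conn_rel \<Sigma> `` {r'}"
  then have "(r, r') \<in> conn_rel \<Sigma>"
    using eq_equiv_class_iff[OF equiv_conn_rel] reps_subset by blast
  then show "r = r'" using rep_eq rep_of_reps r by metis
qed

lemma components_eq: "components \<Sigma> = (\<lambda>r. conn_rel \<Sigma> `` {r}) ` reps"
proof -
  have "conn_rel \<Sigma> `` {v} = conn_rel \<Sigma> `` {rep v}" if "v \<in> verts \<Sigma>" for v
    using equiv_class_eq[OF equiv_conn_rel rep_conn[OF that]] .
  then have "(\<lambda>r. conn_rel \<Sigma> `` {r}) ` reps = (\<lambda>v. conn_rel \<Sigma> `` {v}) ` verts \<Sigma>"
    unfolding reps_def image_image by (intro image_cong) simp_all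
  then show ?thesis
    by (auto simp: components_def quotient_def)
qed

lemma num_comps_eq: "num_comps \<Sigma> = card reps"
  unfolding num_comps_def components_eq by (rule card_image[OF inj_on_component])

lemma signed_graph_induced_sub: "C \<subseteq> verts \<Sigma> \<Longrightarrow> signed_graph (induced_sub \<Sigma> C)"
  using finite_verts finite_edges esign_values
  by (unfold_locales) (auto simp: induced_sub_def intro: finite_subset)

text \<open>A walk cannot leave the component in which it starts. This allows the criterion for
  negative closed walks to be applied to a single component.\<close>

lemma walk_induced_sub:
  assumes "walk \<Sigma> u ds v" "(r, u) \<in> conn_rel \<Sigma>"
  shows "walk (induced_sub \<Sigma> (conn_rel \<Sigma> `` {r})) u ds v"
  using assms
proof (induction ds arbitrary: u)
  case (Cons d ds)
  let ?C = "conn_rel \<Sigma> `` {r}"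
  have d: "fst d \<in> edges \<Sigma>" "dart_src \<Sigma> d = u" "walk \<Sigma> (dart_tgt \<Sigma> d) ds v"
    using Cons.prems by auto
  have "(u, dart_tgt \<Sigma> d) \<in> conn_rel \<Sigma>"
    using d(1,2) endpoint_in_verts
    by (auto simp: conn_rel_def adj_rel_def dart_src_def dart_tgt_def)
  then have t: "(r, dart_tgt \<Sigma> d) \<in> conn_rel \<Sigma>"
    using Cons.prems(2) equiv_conn_rel by (meson equivE transD)
  have "endpoint \<Sigma> (fst d) b \<in> ?C" for b
    using t Cons.prems(2) d(2) by (cases "b = snd d") (auto simp: dart_src_def dart_tgt_def)
  then have "fst d \<in> edges (induced_sub \<Sigma> ?C)"
    using d(1) by (simp add: induced_sub_def)
  moreover have "dart_src (induced_sub \<Sigma> ?C) d = u" "dart_tgt (induced_sub \<Sigma> ?C) d = dart_tgt \<Sigma> d"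
    using d(2) by (simp_all add: induced_sub_def dart_src_def dart_tgt_def)
  ultimately show ?case
    using Cons.IH[OF d(3) t] by simp
qed simp

text \<open>A negative closed walk at \<open>r\<close> stays in the component and makes it
  unbalanced. If there is none, \<open>walk_sign\<close> is a switching function on the component,
  which is therefore balanced.\<close>

lemma unbalanced_component_iff:
  assumes r: "r \<in> reps"
  shows "\<not> balanced (induced_sub \<Sigma> (conn_rel \<Sigma> `` {r})) \<longleftrightarrow> negative r"
proof -
  let ?C = "conn_rel \<Sigma> `` {r}"
  have "?C \<subseteq> verts \<Sigma>" by (auto simp: conn_rel_def)
  then interpret C: signed_graph "induced_sub \<Sigma> ?C" by (rule signed_graph_induced_sub)
  have rr: "(r, r) \<in> conn_rel \<Sigma>"
    using r reps_subset by (auto simp: conn_rel_def)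
  show ?thesis
  proof
    assume "negative r"
    then obtain ds where "walk \<Sigma> r ds r" "wsign \<Sigma> ds = -1"
      by (auto simp: negative_def)
    then show "\<not> balanced (induced_sub \<Sigma> ?C)"
      using C.negative_closed_walk_unbalanced[OF walk_induced_sub] rr wsign_induced_sub by metis
  next
    assume nb: "\<not> balanced (induced_sub \<Sigma> ?C)"
    show "negative r"
    proof (rule ccontr)
      assume "\<not> negative r"
      moreover have "rep v = r" if "v \<in> ?C" for v
        using that rep_eq rep_of_reps[OF r] by force
      ultimately have "balanced (induced_sub \<Sigma> ?C)"
        using walk_sign_values esign_eq_walk_sign \<open>?C \<subseteq> verts \<Sigma>\<close>
        by (intro C.switching_balanced[of walk_sign]) (auto simp: induced_sub_def)
      then show False using nb by simp
    qed
  qed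
qed

lemma num_unbalanced_eq: "num_unbalanced \<Sigma> = card {r \<in> reps. negative r}"
proof -
  have "{C \<in> components \<Sigma>. \<not> balanced (induced_sub \<Sigma> C)} =
      (\<lambda>r. conn_rel \<Sigma> `` {r}) ` {r \<in> reps. negative r}"
    using unbalanced_component_iff unfolding components_eq by blast
  then show ?thesis
    unfolding num_unbalanced_def
    by (simp add: card_image inj_on_subset[OF inj_on_component])
qed

lemma num_comps_split: "num_comps \<Sigma> = num_balanced \<Sigma> + num_unbalanced \<Sigma>"
proof -
  have "finite (components \<Sigma>)" by (simp add: components_eq finite_reps)
  then have "card {C \<in> components \<Sigma>. balanced (induced_sub \<Sigma> C)} +
      card {C \<in> components \<Sigma>. \<not> balanced (induced_sub \<Sigma> C)} =
      card ({C \<in> components \<Sigma>. balanced (induced_sub \<Sigma> C)} \<union>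
        {C \<in> components \<Sigma>. \<not> balanced (induced_sub \<Sigma> C)})"
    by (intro card_Un_disjoint[symmetric]) auto
  also have "\<dots> = card (components \<Sigma>)"
    by (rule arg_cong[of _ _ card]) blast
  finally show ?thesis
    by (simp add: num_comps_def num_balanced_def num_unbalanced_def)
qed

lemma num_comps_le: "num_comps \<Sigma> \<le> card (verts \<Sigma>)"
  unfolding num_comps_eq by (rule card_mono[OF finite_verts reps_subset])

end

section \<open>Signs acting on a group, and functions supported on a set\<close>

lemma sign_mult_zero [simp]: "sign_mult s 0 = 0"
  by (simp add: sign_mult_def)

lemma sign_mult_one [simp]: "sign_mult 1 x = x"
  by (simp add: sign_mult_def)

lemma sign_mult_add: "sign_mult s (x + y) = sign_mult s x + sign_mult s y"
  by (simp add: sign_mult_def)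

lemma sign_mult_minus: "sign_mult s (- x) = - sign_mult s x"
  by (simp add: sign_mult_def)

lemma sign_mult_sum: "sign_mult s (\<Sum>i\<in>I. h i) = (\<Sum>i\<in>I. sign_mult s (h i))"
  by (simp add: sign_mult_def sum_negf)

lemma sign_mult_mult:
  "s \<in> {-1, 1} \<Longrightarrow> t \<in> {-1, 1} \<Longrightarrow> sign_mult s (sign_mult t x) = sign_mult (s * t) x"
  by (auto simp: sign_mult_def)

lemma sign_mult_inj: "sign_mult s x = sign_mult s y \<longleftrightarrow> x = y"
  by (simp add: sign_mult_def)

text \<open>Functions vanish outside \<open>A\<close> instead of being undefined there. They are
  thus closed under pointwise addition, and functions on a subset of \<open>A\<close> are literally
  functions on \<open>A\<close>.\<close>

definition supported_on :: "'a set \<Rightarrow> ('a \<Rightarrow> 'g::zero) set" where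
  "supported_on A = {f. \<forall>x. x \<notin> A \<longrightarrow> f x = 0}"

lemma bij_betw_supported_on:
  "bij_betw (\<lambda>f. restrict f A) {f \<in> supported_on A. \<forall>x\<in>A. f x \<in> B x} (Pi\<^sub>E A B)"
proof (rule bij_betw_byWitness[where f' = "\<lambda>f x. if x \<in> A then f x else 0"])
  show "\<forall>f\<in>{f \<in> supported_on A. \<forall>x\<in>A. f x \<in> B x}.
      (\<lambda>x. if x \<in> A then restrict f A x else 0) = f"
    by (auto simp: supported_on_def fun_eq_iff)
  show "\<forall>f\<in>Pi\<^sub>E A B. restrict (\<lambda>x. if x \<in> A then f x else 0) A = f"
    by (auto simp: fun_eq_iff PiE_def extensional_def restrict_def)
qed (auto simp: supported_on_def PiE_def)

lemma card_supported_on_Pi: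
  assumes "finite A"
  shows "card {f \<in> supported_on A. \<forall>x\<in>A. f x \<in> B x} = (\<Prod>x\<in>A. card (B x))"
  using bij_betw_same_card[OF bij_betw_supported_on[of A B]] card_PiE[OF assms, of B] by simp

lemma card_supported_on:
  assumes "finite A"
  shows "card (supported_on A :: ('a \<Rightarrow> 'g::{finite, zero}) set) = CARD('g) ^ card A"
  using card_supported_on_Pi[OF assms, of "\<lambda>_. UNIV :: 'g set"] by simp

lemma finite_supported_on:
  assumes "finite A"
  shows "finite (supported_on A :: ('a \<Rightarrow> 'g::{finite, zero}) set)"
proof -
  have "finite (Pi\<^sub>E A (\<lambda>_. UNIV :: 'g set))" using assms by (intro finite_PiE) auto
  then show ?thesis
    using bij_betw_finite[OF bij_betw_supported_on[of A "\<lambda>_. UNIV :: 'g set"]] by simp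
qed

text \<open>The delta function at \<open>v\<close> with value \<open>x\<close>, used both on
  vertices and on edges.\<close>

definition point :: "'v \<Rightarrow> 'g \<Rightarrow> 'v \<Rightarrow> 'g::zero" where
  "point v x w = (if w = v then x else 0)"

section \<open>The boundary map and its image\<close>

locale oriented_signed_graph = signed_graph \<Sigma> for \<Sigma> :: "('v, 'e) sgraph" +
  fixes \<omega> :: "'e \<Rightarrow> bool \<Rightarrow> int"
  assumes compatible: "compatible \<Sigma> \<omega>"
begin

lemma orientation_values: "e \<in> edges \<Sigma> \<Longrightarrow> \<omega> e b \<in> {-1, 1}"
  using compatible by (auto simp: compatible_def)

lemma esign_eq_orientation: "e \<in> edges \<Sigma> \<Longrightarrow> esign \<Sigma> e = - (\<omega> e False * \<omega> e True)"
  using compatible by (auto simp: compatible_def)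

text \<open>The sum over half-edges at \<open>v\<close> is written with an indicator, over all edges
  and both half-edges, so that sums can be interchanged. A loop at \<open>v\<close> contributes two
  terms.\<close>

definition boundary :: "('e \<Rightarrow> 'g::ab_group_add) \<Rightarrow> 'v \<Rightarrow> 'g" where
  "boundary f v =
     (\<Sum>e\<in>edges \<Sigma>. \<Sum>b\<in>UNIV. if endpoint \<Sigma> e b = v then sign_mult (\<omega> e b) (f e) else 0)"

definition boundaries :: "('v \<Rightarrow> 'g::ab_group_add) set" where
  "boundaries = boundary ` supported_on (edges \<Sigma>)"

definition comp_sum :: "('v \<Rightarrow> 'g::ab_group_add) \<Rightarrow> 'v \<Rightarrow> 'g" where
  "comp_sum g r = (\<Sum>v | v \<in> verts \<Sigma> \<and> rep v = r. sign_mult (walk_sign v) (g v))"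

definition comp_values :: "'v \<Rightarrow> 'g::ab_group_add set" where
  "comp_values r = (if negative r then range (\<lambda>x. x + x) else {0})"

lemma boundary_add: "boundary (\<lambda>e. f e + f' e) v = boundary f v + boundary f' v"
  unfolding boundary_def by (auto simp: sign_mult_add simp flip: sum.distrib intro!: sum.cong)

lemma boundary_minus: "boundary (\<lambda>e. - f e) v = - boundary f v"
  unfolding boundary_def by (auto simp: sign_mult_minus simp flip: sum_negf intro!: sum.cong)

lemma boundary_zero: "boundary (\<lambda>e. 0) v = 0"
  unfolding boundary_def by (simp cong: if_cong)

lemma boundary_outside: "v \<notin> verts \<Sigma> \<Longrightarrow> boundary f v = 0"
  unfolding boundary_def using endpoint_in_verts by (intro sum.neutral ballI) auto

lemma boundary_point:
  assumes "e \<in> edges \<Sigma>"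
  shows "boundary (point e y) v =
    (\<Sum>b\<in>UNIV. if endpoint \<Sigma> e b = v then sign_mult (\<omega> e b) y else 0)"
proof -
  have "boundary (point e y) v =
      (\<Sum>e'\<in>edges \<Sigma>. if e' = e then
        (\<Sum>b\<in>UNIV. if endpoint \<Sigma> e b = v then sign_mult (\<omega> e b) y else 0) else 0)"
    unfolding boundary_def by (intro sum.cong) (auto simp: point_def cong: if_cong)
  then show ?thesis using assms finite_edges by simp
qed

lemma boundaries_zero: "(\<lambda>v. 0) \<in> boundaries"
proof -
  have "(\<lambda>v. 0) = boundary (\<lambda>e. 0)" by (simp add: fun_eq_iff boundary_zero)
  moreover have "(\<lambda>e. 0) \<in> supported_on (edges \<Sigma>)" by (simp add: supported_on_def)
  ultimately show ?thesis unfolding boundaries_def by (rule image_eqI)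
qed

lemma boundaries_add:
  assumes "g \<in> boundaries" "h \<in> boundaries"
  shows "(\<lambda>v. g v + h v) \<in> boundaries"
proof -
  obtain f f' where f: "f \<in> supported_on (edges \<Sigma>)" "f' \<in> supported_on (edges \<Sigma>)"
    and "g = boundary f" "h = boundary f'"
    using assms by (auto simp: boundaries_def)
  then have "(\<lambda>v. g v + h v) = boundary (\<lambda>e. f e + f' e)"
    by (simp add: fun_eq_iff boundary_add)
  moreover have "(\<lambda>e. f e + f' e) \<in> supported_on (edges \<Sigma>)"
    using f by (simp add: supported_on_def)
  ultimately show ?thesis unfolding boundaries_def by blast
qed

lemma boundaries_sum:
  assumes "finite I" "\<And>i. i \<in> I \<Longrightarrow> h i \<in> boundaries"
  shows "(\<lambda>v. \<Sum>i\<in>I. h i v) \<in> boundaries"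
  using assms by (induction I rule: finite_induct) (auto intro: boundaries_add boundaries_zero)

text \<open>Put the value \<open>\<omega> e b * x\<close> on the edge. The half-edge that is left
  then contributes \<open>x\<close>, and by compatibility the other one contributes
  \<open>- esign \<Sigma> e * x\<close>. For a loop the two terms add up at one vertex.\<close>

lemma dart_boundary:
  assumes e: "fst d \<in> edges \<Sigma>"
  shows "(\<lambda>w. point (dart_src \<Sigma> d) x w - point (dart_tgt \<Sigma> d) (sign_mult (esign \<Sigma> (fst d)) x) w)
    \<in> boundaries"
proof -
  obtain e b where d: "d = (e, b)" by (cases d)
  have e: "e \<in> edges \<Sigma>" using assms d by simp
  let ?y = "sign_mult (\<omega> e b) x"
  have 1: "sign_mult (\<omega> e b) ?y = x"
    using orientation_values[OF e, of b] by (auto simp: sign_mult_def)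
  have 2: "sign_mult (\<omega> e (\<not> b)) ?y = - sign_mult (esign \<Sigma> e) x"
    using orientation_values[OF e, of False] orientation_values[OF e, of True]
      esign_eq_orientation[OF e]
    by (cases b) (auto simp: sign_mult_def)
  have U: "(UNIV :: bool set) = {b, \<not> b}" by auto
  have "boundary (point e ?y) w =
      point (dart_src \<Sigma> d) x w - point (dart_tgt \<Sigma> d) (sign_mult (esign \<Sigma> (fst d)) x) w" for w
    unfolding boundary_point[OF e] U using 1 2
    by (auto simp: d dart_src_def dart_tgt_def point_def)
  then have "(\<lambda>w. point (dart_src \<Sigma> d) x w -
      point (dart_tgt \<Sigma> d) (sign_mult (esign \<Sigma> (fst d)) x) w) = boundary (point e ?y)"
    by (simp add: fun_eq_iff)
  moreover have "point e ?y \<in> supported_on (edges \<Sigma>)"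
    using e by (auto simp: supported_on_def point_def)
  ultimately show ?thesis unfolding boundaries_def by (rule image_eqI)
qed

text \<open>The boundaries of the darts telescope. Modulo boundaries, a value can thus be carried
  along a walk at the cost of the sign of the walk.\<close>

lemma walk_boundary:
  assumes "walk \<Sigma> u ds v"
  shows "(\<lambda>w. point u x w - point v (sign_mult (wsign \<Sigma> ds) x) w) \<in> boundaries"
  using assms
proof (induction ds arbitrary: u x)
  case Nil
  then show ?case by (simp add: boundaries_zero)
next
  case (Cons d ds)
  let ?t = "dart_tgt \<Sigma> d" and ?y = "sign_mult (esign \<Sigma> (fst d)) x"
  have d: "fst d \<in> edges \<Sigma>" "dart_src \<Sigma> d = u" "walk \<Sigma> ?t ds v"
    using Cons.prems by auto
  have "sign_mult (wsign \<Sigma> ds) ?y = sign_mult (wsign \<Sigma> (d # ds)) x"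
    using sign_mult_mult[OF wsign_values[OF d(3)] esign_values[OF d(1)]] by (simp add: mult.commute)
  then show ?case
    using boundaries_add[OF dart_boundary[OF d(1), of x] Cons.IH[OF d(3), of ?y]] d(2)
    by simp
qed

lemma comp_values_zero: "0 \<in> comp_values r"
  unfolding comp_values_def by (auto intro: range_eqI[of _ _ 0])

lemma comp_values_add: "x \<in> comp_values r \<Longrightarrow> y \<in> comp_values r \<Longrightarrow> x + y \<in> comp_values r"
proof (cases "negative r")
  case True
  assume "x \<in> comp_values r" "y \<in> comp_values r"
  then obtain a b where "x = a + a" "y = b + b" using True by (auto simp: comp_values_def)
  then have "x + y = (a + b) + (a + b)" by simp
  then show ?thesis using True unfolding comp_values_def by auto
qed (simp add: comp_values_def)

lemma comp_values_sum: "(\<And>i. i \<in> I \<Longrightarrow> h i \<in> comp_values r) \<Longrightarrow> sum h I \<in> comp_values r"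
  by (induction I rule: infinite_finite_induct) (auto intro: comp_values_add comp_values_zero)

text \<open>After regrouping by edges, an edge of the component contributes two terms
  \<open>f e\<close> or \<open>- f e\<close>, hence \<open>0\<close> or the double of an element. If
  \<open>r\<close> is not negative, \<open>esign_eq_walk_sign\<close> and compatibility make the two
  signs opposite, so they cancel.\<close>

lemma comp_sum_boundary:
  fixes f :: "'e \<Rightarrow> 'g::ab_group_add"
  shows "comp_sum (boundary f) r \<in> comp_values r"
proof -
  let ?V = "{v \<in> verts \<Sigma>. rep v = r}"
  have fin: "finite ?V" using finite_verts by simp
  have "comp_sum (boundary f) r = (\<Sum>v\<in>?V. \<Sum>e\<in>edges \<Sigma>. \<Sum>b\<in>UNIV.
      if endpoint \<Sigma> e b = v then sign_mult (walk_sign v) (sign_mult (\<omega> e b) (f e)) else 0)"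
    unfolding comp_sum_def boundary_def sign_mult_sum by (intro sum.cong refl) simp
  also have "\<dots> = (\<Sum>e\<in>edges \<Sigma>. \<Sum>v\<in>?V. \<Sum>b\<in>UNIV.
      if endpoint \<Sigma> e b = v then sign_mult (walk_sign v) (sign_mult (\<omega> e b) (f e)) else 0)"
    by (rule sum.swap)
  also have "\<dots> = (\<Sum>e\<in>edges \<Sigma>. \<Sum>b\<in>UNIV. \<Sum>v\<in>?V.
      if endpoint \<Sigma> e b = v then sign_mult (walk_sign v) (sign_mult (\<omega> e b) (f e)) else 0)"
    by (intro sum.cong refl sum.swap)
  also have "\<dots> = (\<Sum>e\<in>edges \<Sigma>. \<Sum>b\<in>UNIV. if endpoint \<Sigma> e b \<in> ?V
      then sign_mult (walk_sign (endpoint \<Sigma> e b)) (sign_mult (\<omega> e b) (f e)) else 0)"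
    by (intro sum.cong refl) (simp only: sum.delta[OF fin] sum.delta'[OF fin])
  also have "\<dots> \<in> comp_values r"
  proof (rule comp_values_sum)
    fix e assume e: "e \<in> edges \<Sigma>"
    let ?u = "endpoint \<Sigma> e False" and ?v = "endpoint \<Sigma> e True"
    have uv: "?u \<in> verts \<Sigma>" "?v \<in> verts \<Sigma>" using e endpoint_in_verts by auto
    note signs = walk_sign_values[OF uv(1)] walk_sign_values[OF uv(2)]
      orientation_values[OF e, of False] orientation_values[OF e, of True]
    have rep: "rep ?v = rep ?u" using rep_endpoint[OF e] .
    let ?s = "sign_mult (walk_sign ?u) (sign_mult (\<omega> e False) (f e)) +
      sign_mult (walk_sign ?v) (sign_mult (\<omega> e True) (f e))"
    have "?s \<in> comp_values (rep ?u)"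
    proof (cases "negative (rep ?u)")
      case True
      have "?s \<in> {0, f e + f e, - f e + - f e}"
        using signs by (auto simp: sign_mult_def)
      moreover have double: "x + x \<in> range (\<lambda>x. x + x)" for x :: 'g by (rule rangeI)
      have "{0, f e + f e, - f e + - f e} \<subseteq> range (\<lambda>x. x + x)"
        using double[of 0] double[of "f e"] double[of "- f e"]
        unfolding add_0 insert_subset by blast
      ultimately have "?s \<in> range (\<lambda>x. x + x)" by blast
      then show ?thesis using True by (simp add: comp_values_def)
    next
      case False
      then have "?s = 0"
        using esign_eq_walk_sign[OF e] esign_eq_orientation[OF e] signs
        by (auto simp: sign_mult_def)
      then show ?thesis using False by (simp add: comp_values_def)
    qed
    then show "(\<Sum>b\<in>UNIV. if endpoint \<Sigma> e b \<in> ?V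
      then sign_mult (walk_sign (endpoint \<Sigma> e b)) (sign_mult (\<omega> e b) (f e)) else 0)
        \<in> comp_values r"
      using uv rep by (auto simp: UNIV_bool comp_values_zero add.commute)
  qed
  finally show ?thesis .
qed

text \<open>
  Modulo boundaries every function on the vertices can be moved along walks to the
  representatives, where its value becomes the component sum. At a representative lying on a
  negative closed walk, transporting a value around this walk shows that its double is a boundary.
\<close>

lemma boundaries_eq:
  "(boundaries :: ('v \<Rightarrow> 'g::ab_group_add) set) =
     {g \<in> supported_on (verts \<Sigma>). \<forall>r\<in>reps. comp_sum g r \<in> comp_values r}"
proof (intro equalityI subsetI)
  fix g :: "'v \<Rightarrow> 'g" assume "g \<in> boundaries"
  then show "g \<in> {g \<in> supported_on (verts \<Sigma>). \<forall>r\<in>reps. comp_sum g r \<in> comp_values r}"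
    by (auto simp: boundaries_def supported_on_def comp_sum_boundary boundary_outside)
next
  fix g :: "'v \<Rightarrow> 'g"
  assume "g \<in> {g \<in> supported_on (verts \<Sigma>). \<forall>r\<in>reps. comp_sum g r \<in> comp_values r}"
  then have g0: "\<And>v. v \<notin> verts \<Sigma> \<Longrightarrow> g v = 0"
    and gr: "\<And>r. r \<in> reps \<Longrightarrow> comp_sum g r \<in> comp_values r"
    by (auto simp: supported_on_def)
  let ?m = "\<lambda>v. sign_mult (walk_sign v) (g v)"
  have "(\<lambda>w. point v (g v) w - point (rep v) (?m v) w) \<in> boundaries" if v: "v \<in> verts \<Sigma>" for v
  proof -
    obtain ds where ds: "walk \<Sigma> (rep v) ds v" "wsign \<Sigma> ds = walk_sign v"
      using walk_sign_walk[OF v] .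
    obtain ds' where ds': "walk \<Sigma> v ds' (rep v)" "wsign \<Sigma> ds' = wsign \<Sigma> ds"
      using walk_reverse[OF ds(1)] .
    show ?thesis using walk_boundary[OF ds'(1), of "g v"] by (simp add: ds ds')
  qed
  then have "(\<lambda>w. \<Sum>v\<in>verts \<Sigma>. point v (g v) w - point (rep v) (?m v) w) \<in> boundaries"
    by (intro boundaries_sum finite_verts)
  moreover have "(\<lambda>w. \<Sum>r\<in>reps. point r (comp_sum g r) w) \<in> boundaries"
  proof (intro boundaries_sum finite_reps)
    fix r assume r: "r \<in> reps"
    show "point r (comp_sum g r) \<in> boundaries"
    proof (cases "negative r")
      case True
      then obtain x where x: "comp_sum g r = x + x"
        using gr[OF r] by (auto simp: comp_values_def)
      obtain ds where "walk \<Sigma> r ds r" "wsign \<Sigma> ds = -1"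
        using True by (auto simp: negative_def)
      then have "(\<lambda>w. point r x w - point r (- x) w) \<in> boundaries"
        using walk_boundary[of r ds r x] by (simp add: sign_mult_def)
      moreover have "(\<lambda>w. point r x w - point r (- x) w) = point r (x + x)"
        by (auto simp: point_def)
      ultimately show ?thesis by (simp add: x)
    next
      case False
      then have "point r (comp_sum g r) = (\<lambda>w. 0)"
        using gr[OF r] by (auto simp: comp_values_def point_def)
      then show ?thesis by (simp add: boundaries_zero)
    qed
  qed
  ultimately have "(\<lambda>w. (\<Sum>v\<in>verts \<Sigma>. point v (g v) w - point (rep v) (?m v) w) +
      (\<Sum>r\<in>reps. point r (comp_sum g r) w)) \<in> boundaries"
    by (rule boundaries_add)
  \<comment> \<open>The values subtracted at a representative \<open>r\<close> collect to
    \<open>comp_sum g r\<close>, which the second sum adds back. Away from representatives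
    \<open>comp_sum g\<close> is an empty sum.\<close>
  moreover have "(\<Sum>v\<in>verts \<Sigma>. point v (g v) w - point (rep v) (?m v) w) +
      (\<Sum>r\<in>reps. point r (comp_sum g r) w) = g w" for w
  proof -
    have "(\<Sum>v\<in>verts \<Sigma>. point v (g v) w) = g w"
      using finite_verts g0 by (simp add: point_def)
    moreover have "(\<Sum>v\<in>verts \<Sigma>. point (rep v) (?m v) w) = comp_sum g w"
      using finite_verts unfolding comp_sum_def point_def
      by (simp add: sum.inter_filter eq_commute[of w])
    moreover have "(\<Sum>r\<in>reps. point r (comp_sum g r) w) = comp_sum g w"
    proof (cases "w \<in> reps")
      case True
      then show ?thesis using finite_reps by (simp add: point_def)
    next
      case False
      then have "{v \<in> verts \<Sigma>. rep v = w} = {}" by (auto simp: reps_def)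
      then have "comp_sum g w = 0" unfolding comp_sum_def by (metis sum.empty)
      then show ?thesis using False finite_reps by (simp add: point_def)
    qed
    ultimately show ?thesis by (simp add: sum_subtractf)
  qed
  ultimately show "g \<in> boundaries" by simp
qed

end

section \<open>Counting boundaries and the cycle space\<close>

context oriented_signed_graph
begin

text \<open>By \<open>boundaries_eq\<close> each component imposes one condition. With the component
  sums as new coordinates at the representatives, every other vertex is free, and a representative
  has \<open>|2G|\<close> choices if negative and one choice otherwise.\<close>

lemma card_boundaries:
  "card (boundaries :: ('v \<Rightarrow> 'g::{finite, ab_group_add}) set) =
     CARD('g) ^ (card (verts \<Sigma>) - num_comps \<Sigma>) *
     card (range (\<lambda>x::'g. x + x)) ^ num_unbalanced \<Sigma>"
proof -
  let ?Z = "supported_on (verts \<Sigma>) :: ('v \<Rightarrow> 'g) set"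
  let ?h = "\<lambda>(g :: 'v \<Rightarrow> 'g) v. if v \<in> reps then comp_sum g v else g v"
  let ?B = "\<lambda>v. if v \<in> reps then comp_values v else UNIV :: 'g set"
  \<comment> \<open>Replacing the values at the representatives by the component sums is a triangular
    substitution, hence bijective.\<close>
  have inj: "inj_on ?h ?Z"
  proof (rule inj_onI)
    fix g g' :: "'v \<Rightarrow> 'g"
    assume g: "g \<in> ?Z" "g' \<in> ?Z" and eq: "?h g = ?h g'"
    have off: "g v = g' v" if "v \<notin> reps" for v
      using fun_cong[OF eq, of v] that by simp
    show "g = g'"
    proof
      fix v
      show "g v = g' v"
      proof (cases "v \<in> reps")
        case True
        let ?V = "{w \<in> verts \<Sigma>. rep w = v}"
        have fin: "finite ?V" using finite_verts by simp
        have v: "v \<in> ?V" using True rep_of_reps reps_subset by auto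
        \<comment> \<open>The other vertices of the component are not representatives, so
          \<open>g\<close> and \<open>g'\<close> agree there already. The coordinate at
          \<open>v\<close> enters with a sign, which can be cancelled.\<close>
        have "comp_sum k v = sign_mult (walk_sign v) (k v) +
            (\<Sum>w\<in>?V - {v}. sign_mult (walk_sign w) (k w))" for k :: "'v \<Rightarrow> 'g"
          unfolding comp_sum_def by (rule sum.remove[OF fin v])
        moreover have "(\<Sum>w\<in>?V - {v}. sign_mult (walk_sign w) (g w)) =
            (\<Sum>w\<in>?V - {v}. sign_mult (walk_sign w) (g' w))"
        proof (intro sum.cong refl)
          fix w assume "w \<in> ?V - {v}"
          then have "w \<notin> reps" using rep_of_reps by auto
          then show "sign_mult (walk_sign w) (g w) = sign_mult (walk_sign w) (g' w)"
            using off by simp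
        qed
        moreover have "comp_sum g v = comp_sum g' v"
          using fun_cong[OF eq, of v] True by simp
        ultimately show ?thesis by (simp add: sign_mult_inj)
      qed (rule off)
    qed
  qed
  have into: "?h ` ?Z \<subseteq> ?Z"
    using reps_subset by (auto simp: supported_on_def)
  have onto: "?h ` ?Z = ?Z"
    using endo_inj_surj[OF finite_supported_on[OF finite_verts] into inj] .
  have img: "?h ` boundaries = {g \<in> ?Z. \<forall>v\<in>verts \<Sigma>. g v \<in> ?B v}"
  proof (intro equalityI subsetI)
    fix k assume "k \<in> ?h ` boundaries"
    then obtain g where "g \<in> ?Z" "\<forall>r\<in>reps. comp_sum g r \<in> comp_values r" "k = ?h g"
      unfolding boundaries_eq by blast
    then show "k \<in> {g \<in> ?Z. \<forall>v\<in>verts \<Sigma>. g v \<in> ?B v}"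
      using into by auto
  next
    fix k assume k: "k \<in> {g \<in> ?Z. \<forall>v\<in>verts \<Sigma>. g v \<in> ?B v}"
    then obtain g where g: "g \<in> ?Z" "k = ?h g" using onto by blast
    have "comp_sum g r \<in> comp_values r" if "r \<in> reps" for r
    proof -
      have "k r \<in> ?B r" using k that reps_subset by blast
      then show ?thesis using that g(2) by simp
    qed
    then have "g \<in> boundaries" using g unfolding boundaries_eq by blast
    then show "k \<in> ?h ` boundaries" using g(2) by blast
  qed
  have sub: "boundaries \<subseteq> ?Z" unfolding boundaries_eq by blast
  have "card (boundaries :: ('v \<Rightarrow> 'g) set) =
      card {g \<in> ?Z. \<forall>v\<in>verts \<Sigma>. g v \<in> ?B v}"
    using card_image[OF inj_on_subset[OF inj sub]] unfolding img by simp
  also have "\<dots> = (\<Prod>v\<in>verts \<Sigma>. card (?B v))"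
    by (rule card_supported_on_Pi[OF finite_verts])
  also have "\<dots> = (\<Prod>v\<in>verts \<Sigma> - reps. card (?B v)) * (\<Prod>v\<in>reps. card (?B v))"
    by (rule prod.subset_diff[OF reps_subset finite_verts])
  also have "(\<Prod>v\<in>verts \<Sigma> - reps. card (?B v)) = CARD('g) ^ (card (verts \<Sigma>) - num_comps \<Sigma>)"
    by (simp add: card_Diff_subset[OF finite_reps reps_subset] num_comps_eq)
  also have "(\<Prod>v\<in>reps. card (?B v)) =
      (\<Prod>v\<in>reps. if negative v then card (range (\<lambda>x::'g. x + x)) else 1)"
    by (intro prod.cong) (auto simp: comp_values_def)
  also have "\<dots> = card (range (\<lambda>x::'g. x + x)) ^ num_unbalanced \<Sigma>"
    unfolding num_unbalanced_eq using finite_reps by (simp flip: prod.inter_filter)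
  finally show ?thesis .
qed

definition cycle_space :: "('e \<Rightarrow> 'g::ab_group_add) set" where
  "cycle_space = {f \<in> supported_on (edges \<Sigma>). \<forall>v. boundary f v = 0}"

text \<open>Each nonempty fibre of the boundary map is a translate of its kernel, by any chosen
  preimage \<open>f0\<close>.\<close>

lemma card_cycle_space_mult:
  "card (cycle_space :: ('e \<Rightarrow> 'g::{finite, ab_group_add}) set) *
     card (boundaries :: ('v \<Rightarrow> 'g) set) = CARD('g) ^ card (edges \<Sigma>)"
proof -
  let ?Z = "supported_on (edges \<Sigma>) :: ('e \<Rightarrow> 'g) set"
  let ?F = "\<lambda>g. {f \<in> ?Z. boundary f = g}"
  have fin: "finite ?Z" by (rule finite_supported_on[OF finite_edges])
  have "card (?F g) = card (cycle_space :: ('e \<Rightarrow> 'g) set)" if g: "g \<in> boundaries" for g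
  proof -
    obtain f0 where f0: "f0 \<in> ?Z" "g = boundary f0"
      using g unfolding boundaries_def by blast
    have "bij_betw (\<lambda>f e. f e + f0 e) cycle_space (?F g)"
    proof (rule bij_betw_byWitness[where f' = "\<lambda>f e. f e + - f0 e"])
      show "(\<lambda>f e. f e + f0 e) ` cycle_space \<subseteq> ?F g"
        using f0 by (auto simp: cycle_space_def supported_on_def boundary_add)
      show "(\<lambda>f e. f e + - f0 e) ` ?F g \<subseteq> cycle_space"
        using f0 unfolding cycle_space_def supported_on_def
        by (auto simp: boundary_add boundary_minus simp del: add_uminus_conv_diff)
    qed auto
    from bij_betw_same_card[OF this] show ?thesis by simp
  qed
  then have "(\<Sum>g\<in>boundaries. card (?F g)) =
      card (cycle_space :: ('e \<Rightarrow> 'g) set) * card (boundaries :: ('v \<Rightarrow> 'g) set)"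
    by simp
  moreover have "(\<Sum>g\<in>boundaries. card (?F g)) = card (\<Union>g\<in>boundaries. ?F g)"
    using fin by (intro card_UN_disjoint[symmetric]) (auto simp: boundaries_def)
  moreover have "(\<Union>g\<in>boundaries. ?F g) = ?Z"
    by (auto simp: boundaries_def)
  ultimately show ?thesis
    using card_supported_on[OF finite_edges, where 'g = 'g] by simp
qed

text \<open>This brings the kernel count into the shape of a Tutte summand: up to sign, the two
  factors are the powers of \<open>Y - 1\<close> and \<open>Z - 1\<close> at the point of
  evaluation.\<close>

lemma card_cycle_space:
  "real (card (cycle_space :: ('e \<Rightarrow> 'g::{finite, ab_group_add}) set)) =
     real CARD('g) powi (int (card (edges \<Sigma>)) - int (card (verts \<Sigma>)) + int (num_balanced \<Sigma>)) *
     (real CARD('g) / real (card (range (\<lambda>x::'g. x + x)))) powi int (num_unbalanced \<Sigma>)"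
proof -
  let ?q = "real CARD('g)" and ?h = "real (card (range (\<lambda>x::'g. x + x)))"
  let ?m = "card (verts \<Sigma>)" and ?k = "num_comps \<Sigma>" and ?u = "num_unbalanced \<Sigma>"
  have q: "?q > 0" by simp
  have h: "?h > 0" by (simp add: card_gt_0_iff)
  have "real (card (cycle_space :: ('e \<Rightarrow> 'g) set)) * (?q ^ (?m - ?k) * ?h ^ ?u)
      = ?q ^ card (edges \<Sigma>)"
    using arg_cong[OF card_cycle_space_mult[where 'g = 'g], of real]
    unfolding card_boundaries by simp
  then have "real (card (cycle_space :: ('e \<Rightarrow> 'g) set)) =
      ?q ^ card (edges \<Sigma>) / (?q ^ (?m - ?k) * ?h ^ ?u)"
    using q h by (simp add: nonzero_eq_divide_eq)
  also have "\<dots> = ?q powi (int (card (edges \<Sigma>)) - int (?m - ?k)) / ?h ^ ?u"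
    using q by (simp add: power_int_diff)
  \<comment> \<open>One factor \<open>?q\<close> for each unbalanced component is split off, to be
    paired with \<open>?h\<close>. The natural subtraction is exact by
    \<open>num_comps_le\<close>.\<close>
  also have "int (card (edges \<Sigma>)) - int (?m - ?k) =
      (int (card (edges \<Sigma>)) - int ?m + int (num_balanced \<Sigma>)) + int ?u"
    using num_comps_le num_comps_split by simp
  also have "?q powi \<dots> =
      ?q powi (int (card (edges \<Sigma>)) - int ?m + int (num_balanced \<Sigma>)) * ?q ^ ?u"
    using q by (subst power_int_add) simp_all
  finally show ?thesis by (simp add: power_divide)
qed

section \<open>Spanning subgraphs, nowhere-zero flows and inclusion-exclusion\<close>

lemma oriented_spanning_sub:
  assumes "A \<subseteq> edges \<Sigma>"
  shows "oriented_signed_graph (spanning_sub \<Sigma> A) \<omega>"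
proof unfold_locales
  show "finite (edges (spanning_sub \<Sigma> A))"
    using assms finite_edges by (simp add: spanning_sub_def finite_subset)
  show "esign (spanning_sub \<Sigma> A) e \<in> {-1, 1}" if "e \<in> edges (spanning_sub \<Sigma> A)" for e
    using that assms esign_values[of e] by (auto simp: spanning_sub_def)
qed (use assms finite_verts endpoint_in_verts compatible in
    \<open>auto simp: spanning_sub_def compatible_def\<close>)

text \<open>Edges outside \<open>A\<close> carry the value \<open>0\<close> and add nothing to a
  boundary, so both graphs yield the same sums under the same orientation.\<close>

lemma cycle_space_spanning_sub:
  assumes "A \<subseteq> edges \<Sigma>"
  shows "oriented_signed_graph.cycle_space (spanning_sub \<Sigma> A) \<omega> =
    {f \<in> cycle_space :: ('e \<Rightarrow> 'g::ab_group_add) set. {e. f e \<noteq> 0} \<subseteq> A}"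
proof -
  interpret A: oriented_signed_graph "spanning_sub \<Sigma> A" \<omega>
    by (rule oriented_spanning_sub[OF assms])
  have "A.boundary f v = boundary f v" if "f \<in> supported_on A" for f :: "'e \<Rightarrow> 'g" and v
    unfolding A.boundary_def boundary_def using assms finite_edges that
    by (intro sum.mono_neutral_cong_left) (auto simp: spanning_sub_def supported_on_def intro!: sum.neutral)
  moreover have "supported_on A = {f \<in> supported_on (edges \<Sigma>). {e. f e \<noteq> 0} \<subseteq> A}"
    using assms by (auto simp: supported_on_def)
  moreover have "edges (spanning_sub \<Sigma> A) = A" by (simp add: spanning_sub_def)
  ultimately show ?thesis
    unfolding A.cycle_space_def cycle_space_def by auto
qed

lemma flow_sum_eq_boundary:
  "(\<Sum>(e, b) \<in> {(e, b). e \<in> edges \<Sigma> \<and> endpoint \<Sigma> e b = v}. sign_mult (\<omega> e b) (f e)) = boundary f v"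
proof -
  have "{(e, b). e \<in> edges \<Sigma> \<and> endpoint \<Sigma> e b = v} =
      {x \<in> edges \<Sigma> \<times> UNIV. endpoint \<Sigma> (fst x) (snd x) = v}"
    by auto
  then have "(\<Sum>(e, b) \<in> {(e, b). e \<in> edges \<Sigma> \<and> endpoint \<Sigma> e b = v}. sign_mult (\<omega> e b) (f e)) =
      (\<Sum>x \<in> edges \<Sigma> \<times> UNIV. if endpoint \<Sigma> (fst x) (snd x) = v
        then sign_mult (\<omega> (fst x) (snd x)) (f (fst x)) else 0)"
    using finite_edges by (simp add: sum.inter_filter split_beta)
  then show ?thesis
    unfolding boundary_def sum.cartesian_product by (simp add: split_beta)
qed

text \<open>Flows are undefined off the edge set, elements of \<open>cycle_space\<close> are zero
  there. Restriction and extension by zero are mutually inverse, and \<open>boundary\<close> reads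
  only values on edges. Nowhere-zero becomes full support.\<close>

lemma card_nowhere_zero_flows:
  "card (nowhere_zero_flows \<Sigma> \<omega> :: ('e \<Rightarrow> 'g::ab_group_add) set) =
     card {f \<in> cycle_space :: ('e \<Rightarrow> 'g) set. {e. f e \<noteq> 0} = edges \<Sigma>}"
proof -
  let ?E = "edges \<Sigma>"
  have cong: "boundary f v = boundary f' v" if "\<And>e. e \<in> ?E \<Longrightarrow> f e = f' e"
    for f f' :: "'e \<Rightarrow> 'g" and v
    unfolding boundary_def using that by (intro sum.cong refl) simp
  \<comment> \<open>Quantifying over all \<open>v\<close> is harmless, as the boundary vanishes
    outside the vertex set.\<close>
  have flow: "is_flow \<Sigma> \<omega> f \<longleftrightarrow> f \<in> ?E \<rightarrow>\<^sub>E UNIV \<and> (\<forall>v. boundary f v = 0)" for f :: "'e \<Rightarrow> 'g"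
    unfolding is_flow_def flow_sum_eq_boundary using boundary_outside by blast
  have "bij_betw (\<lambda>f. restrict f ?E) {f \<in> cycle_space :: ('e \<Rightarrow> 'g) set. {e. f e \<noteq> 0} = ?E}
    (nowhere_zero_flows \<Sigma> \<omega>)"
  proof (rule bij_betw_byWitness[where f' = "\<lambda>f x. if x \<in> ?E then f x else 0"])
    show "(\<lambda>f. restrict f ?E) ` {f \<in> cycle_space :: ('e \<Rightarrow> 'g) set. {e. f e \<noteq> 0} = ?E}
        \<subseteq> nowhere_zero_flows \<Sigma> \<omega>"
    proof
      fix k assume "k \<in> (\<lambda>f. restrict f ?E) ` {f \<in> cycle_space :: ('e \<Rightarrow> 'g) set. {e. f e \<noteq> 0} = ?E}"
      then obtain f where f: "f \<in> cycle_space" "{e. f e \<noteq> 0} = ?E" and k: "k = restrict f ?E"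
        by auto
      have "boundary k v = 0" for v
        using cong[of k f v] f(1) by (simp add: k cycle_space_def)
      then show "k \<in> nowhere_zero_flows \<Sigma> \<omega>"
        using f(2) by (auto simp: nowhere_zero_flows_def flow k)
    qed
    show "(\<lambda>f x. if x \<in> ?E then f x else 0) ` nowhere_zero_flows \<Sigma> \<omega>
        \<subseteq> {f \<in> cycle_space :: ('e \<Rightarrow> 'g) set. {e. f e \<noteq> 0} = ?E}"
    proof
      fix k assume "k \<in> (\<lambda>f x. if x \<in> ?E then f x else (0::'g)) ` nowhere_zero_flows \<Sigma> \<omega>"
      then obtain f where f: "f \<in> nowhere_zero_flows \<Sigma> \<omega>" and k: "k = (\<lambda>x. if x \<in> ?E then f x else 0)"
        by auto
      have "boundary k v = 0" for v
        using cong[of k f v] f by (simp add: k nowhere_zero_flows_def flow)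
      then show "k \<in> {f \<in> cycle_space :: ('e \<Rightarrow> 'g) set. {e. f e \<noteq> 0} = ?E}"
        using f by (auto simp: nowhere_zero_flows_def cycle_space_def supported_on_def k)
    qed
  qed (auto simp: cycle_space_def supported_on_def nowhere_zero_flows_def is_flow_def
      fun_eq_iff PiE_def extensional_def restrict_def)
  from bij_betw_same_card[OF this] show ?thesis by simp
qed

text \<open>Sorting the flows supported in \<open>S\<close> by their exact support gives a sum over
  the subsets of \<open>S\<close>. Moebius inversion recovers the number with support the full edge
  set.\<close>

lemma card_nowhere_zero_flows_inclusion_exclusion:
  "real (card (nowhere_zero_flows \<Sigma> \<omega> :: ('e \<Rightarrow> 'g::{finite, ab_group_add}) set)) =
     (\<Sum>A\<in>Pow (edges \<Sigma>). (-1) ^ (card (edges \<Sigma>) - card A) *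
       real (card {f \<in> cycle_space :: ('e \<Rightarrow> 'g) set. {e. f e \<noteq> 0} \<subseteq> A}))"
proof -
  have fin: "finite (cycle_space :: ('e \<Rightarrow> 'g) set)"
    by (rule finite_subset[OF _ finite_supported_on[OF finite_edges]]) (auto simp: cycle_space_def)
  have "real (card {f \<in> cycle_space :: ('e \<Rightarrow> 'g) set. {e. f e \<noteq> 0} \<subseteq> S}) =
      (\<Sum>B\<in>Pow S. real (card {f \<in> cycle_space :: ('e \<Rightarrow> 'g) set. {e. f e \<noteq> 0} = B}))"
    if "finite S" for S
  proof -
    have "{f \<in> cycle_space :: ('e \<Rightarrow> 'g) set. {e. f e \<noteq> 0} \<subseteq> S} =
        (\<Union>B\<in>Pow S. {f \<in> cycle_space. {e. f e \<noteq> 0} = B})"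
      by auto
    also have "card \<dots> = (\<Sum>B\<in>Pow S. card {f \<in> cycle_space :: ('e \<Rightarrow> 'g) set. {e. f e \<noteq> 0} = B})"
      using that fin by (intro card_UN_disjoint) auto
    finally show ?thesis by simp
  qed
  from inclusion_exclusion_mobius[OF this finite_edges] show ?thesis
    unfolding card_nowhere_zero_flows .
qed

end

text \<open>The two sums over edge subsets are compared term by term. At the given point the bases
  are \<open>-1\<close>, \<open>-|G|\<close> and \<open>-|G|/|2G|\<close>, so
  \<open>card_cycle_space\<close> for \<open>(V, A)\<close> settles the absolute values and only the
  signs remain.\<close>

theorem theorem5p3:
  fixes \<Sigma> :: "('v, 'e) sgraph" and \<omega> :: "'e \<Rightarrow> bool \<Rightarrow> int"
  assumes "signed_graph \<Sigma>" and "compatible \<Sigma> \<omega>"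
  shows "real (card (nowhere_zero_flows \<Sigma> \<omega> :: ('e \<Rightarrow> 'g::{finite, ab_group_add}) set)) =
    (-1) powi (int (card (edges \<Sigma>)) - int (card (verts \<Sigma>)) + int (num_comps \<Sigma>)) *
    signed_tutte \<Sigma> 0 (1 - real CARD('g))
      (1 - real CARD('g) / real (card (range (\<lambda>x::'g. x + x))))"
proof -
  interpret oriented_signed_graph \<Sigma> \<omega>
    using assms by (simp add: oriented_signed_graph_def oriented_signed_graph_axioms_def)
  let ?q = "real CARD('g)" and ?h = "real (card (range (\<lambda>x::'g. x + x)))"
  let ?E = "edges \<Sigma>" and ?n = "int (card (verts \<Sigma>))"
  have summand: "(-1) ^ (card ?E - card A) *
      real (card {f \<in> cycle_space :: ('e \<Rightarrow> 'g) set. {e. f e \<noteq> 0} \<subseteq> A}) =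
      (-1) powi (int (card ?E) - ?n + int (num_comps \<Sigma>)) *
      ((0 - 1) powi (int (num_comps (spanning_sub \<Sigma> A)) - int (num_comps \<Sigma>)) *
       ((1 - ?q) - 1) powi (int (card A) - ?n + int (num_balanced (spanning_sub \<Sigma> A))) *
       ((1 - ?q / ?h) - 1) powi int (num_unbalanced (spanning_sub \<Sigma> A)))"
    if "A \<in> Pow ?E" for A
  proof -
    have A: "A \<subseteq> ?E" using that by simp
    interpret A: oriented_signed_graph "spanning_sub \<Sigma> A" \<omega>
      by (rule oriented_spanning_sub[OF A])
    let ?S = "spanning_sub \<Sigma> A"
    have S: "edges ?S = A" "verts ?S = verts \<Sigma>" by (simp_all add: spanning_sub_def)
    define a where "a = int (card ?E) - ?n + int (num_comps \<Sigma>)"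
    define b where "b = int (num_comps ?S) - int (num_comps \<Sigma>)"
    define c where "c = int (card A) - ?n + int (num_balanced ?S)"
    define d where "d = int (num_unbalanced ?S)"
    have le: "card A \<le> card ?E" by (rule card_mono[OF finite_edges A])
    \<comment> \<open>The numbers of balanced and unbalanced components in \<open>c\<close> and
      \<open>d\<close> add up to the \<open>num_comps ?S\<close> in \<open>b\<close>, and
      \<open>?n\<close> occurs twice. Modulo 2 only the number of edges outside \<open>A\<close> is
      left.\<close>
    have "a + b + c + d = int (card ?E - card A) + 2 * (int (card A) - ?n + int (num_comps ?S))"
      using le A.num_comps_split by (simp add: a_def b_def c_def d_def)
    then have "even (a + b + c + d) \<longleftrightarrow> even (card ?E - card A)"
      by simp
    then have sgn: "(-1::real) powi (a + b + c + d) = (-1) ^ (card ?E - card A)"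
      by (simp add: power_int_minus_left minus_one_power_iff)
    have neg: "(- x) powi i = (-1) powi i * x powi i" for x :: real and i :: int
      by (simp add: power_int_minus_left)
    have "(-1) ^ (card ?E - card A) * (?q powi c * (?q / ?h) powi d) =
        (-1) powi a * ((-1) powi b * (- ?q) powi c * (- (?q / ?h)) powi d)"
      unfolding sgn[symmetric] neg[of ?q] neg[of "?q / ?h"] by (simp add: power_int_add)
    moreover have "real (card {f \<in> cycle_space :: ('e \<Rightarrow> 'g) set. {e. f e \<noteq> 0} \<subseteq> A}) =
        ?q powi c * (?q / ?h) powi d"
      using A.card_cycle_space[where 'g = 'g]
      unfolding cycle_space_spanning_sub[OF A] S c_def d_def .
    ultimately show ?thesis
      unfolding a_def b_def c_def d_def by simp
  qed
  show ?thesis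
    unfolding card_nowhere_zero_flows_inclusion_exclusion signed_tutte_def sum_distrib_left
    by (intro sum.cong refl summand)
qed

end
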